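(* Identify $(\mathbb{R}^4)^{\otimes2}$ with real $4\times4$ matrices, so that $\mathcal{S}_2=\{(P,Q)\in M_4(\mathbb{R})^2: P,Q\text{ entrywise nonnegative},\ KPK=Q\}$. Then $\mathcal{S}_2$ has exactly $252$ extremal rays and is the conic hull of the following three families, each of whose members generates an extremal ray: (i) 36 "boxes": $\big((|i\rangle+|j\rangle)(\langle k|+\langle l|),\ (|i'\rangle+|j'\rangle)(\langle k'|+\langle l'|)\big)$ for $2$-element subsets $\{i,j\},\{k,l\}\subset\{1,2,3,4\}$, where $\{i',j'\}$ and $\{k',l'\}$ are their complements in $\{1,2,3,4\}$; (ii) 24 "diagonals": $(U_\sigma,U_\sigma)$ for permutation matrices $U_\sigma$, $\sigma\in S_4$; (iii) 192 "crosses": the distinct pairs of the form $(U_{\sigma_1}P_3U_{\sigma_2},\ U_{\sigma_1}P_3^TU_{\sigma_2})$ or $(U_{\sigma_1}P_3^TU_{\sigma_2},\ U_{\sigma_1}P_3U_{\sigma_2})$, $\sigma_1,\sigma_2\in S_4$, where $P_3=\begin{pmatrix}1&0&0&0\\0&1&0&0\\0&0&1&0\\1&1&1&0\end{pmatrix}$.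
   Context: $K=\frac12\begin{pmatrix}-1&1&1&1\\1&-1&1&1\\1&1&-1&1\\1&1&1&-1\end{pmatrix}$. $\mathcal{S}_2$ is the cone of Pauli PPT spectra for $N=2$: pairs of entrywise nonnegative vectors $|p\rangle,|q\rangle\in(\mathbb{R}^4)^{\otimes2}$ with $K^{\otimes2}|p\rangle=|q\rangle$; under the identification $|i\rangle\otimes|j\rangle\leftrightarrow|i\rangle\langle j|$ the condition becomes $KPK^T=KPK=Q$. $|1\rangle,\dots,|4\rangle$ is the standard basis of $\mathbb{R}^4$. *)

theory Defs
  imports "HOL-Analysis.Analysis"
begin

type_synonym mat4 = "real^4^4"

definition Kmat :: mat4 where
  "Kmat = (\<chi> i j. if i = j then - 1/2 else 1/2)"

definition nonneg_mat :: "mat4 \<Rightarrow> bool" where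
  "nonneg_mat P \<longleftrightarrow> (\<forall>i j. P $ i $ j \<ge> 0)"

text \<open>The cone S_2 of Pauli PPT spectra for N = 2, as pairs of 4x4 matrices.\<close>
definition S2 :: "(mat4 \<times> mat4) set" where
  "S2 = {(P, Q). nonneg_mat P \<and> nonneg_mat Q \<and> Kmat ** P ** Kmat = Q}"

definition ray :: "'a::real_vector \<Rightarrow> 'a set" where
  "ray x = {t *\<^sub>R x | t. t \<ge> 0}"

definition extreme_ray_gen :: "'a::real_vector set \<Rightarrow> 'a \<Rightarrow> bool" where
  "extreme_ray_gen C x \<longleftrightarrow> x \<in> C \<and> x \<noteq> 0 \<and>
     (\<forall>y z. y \<in> C \<longrightarrow> z \<in> C \<longrightarrow> y + z = x \<longrightarrow> y \<in> ray x \<and> z \<in> ray x)"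

definition extremal_rays :: "'a::real_vector set \<Rightarrow> 'a set set" where
  "extremal_rays C = {ray x | x. extreme_ray_gen C x}"

text \<open>Index 1..4 of the paper: the elements 1,2,3,4 of the type 4
  (in which the numeral 4 denotes the same element as 0).\<close>

text \<open>(|i>+|j>)(<k|+<l|) with A = {i,j}, B = {k,l}.\<close>
definition box_mat :: "4 set \<Rightarrow> 4 set \<Rightarrow> mat4" where
  "box_mat A B = (\<chi> a b. if a \<in> A \<and> b \<in> B then 1 else 0)"

definition boxes :: "(mat4 \<times> mat4) set" where
  "boxes = {(box_mat A B, box_mat (- A) (- B)) | A B. card A = 2 \<and> card B = 2}"

text \<open>Permutation matrix U_sigma with U_sigma |j> = |sigma j>.\<close>
definition perm_mat :: "(4 \<Rightarrow> 4) \<Rightarrow> mat4" where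
  "perm_mat \<sigma> = (\<chi> i j. if \<sigma> j = i then 1 else 0)"

definition diagonals :: "(mat4 \<times> mat4) set" where
  "diagonals = {(perm_mat \<sigma>, perm_mat \<sigma>) | \<sigma>. \<sigma> permutes (UNIV :: 4 set)}"

definition P3 :: mat4 where
  "P3 = (\<chi> a b. if a \<noteq> 4 then (if a = b then 1 else 0)
                 else (if b \<noteq> 4 then 1 else 0))"

definition crosses :: "(mat4 \<times> mat4) set" where
  "crosses = {(perm_mat \<sigma>1 ** P3 ** perm_mat \<sigma>2, perm_mat \<sigma>1 ** transpose P3 ** perm_mat \<sigma>2)
                | \<sigma>1 \<sigma>2. \<sigma>1 permutes (UNIV :: 4 set) \<and> \<sigma>2 permutes (UNIV :: 4 set)}
           \<union> {(perm_mat \<sigma>1 ** transpose P3 ** perm_mat \<sigma>2, perm_mat \<sigma>1 ** P3 ** perm_mat \<sigma>2)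
                | \<sigma>1 \<sigma>2. \<sigma>1 permutes (UNIV :: 4 set) \<and> \<sigma>2 permutes (UNIV :: 4 set)}"

end

theory Submission
  imports Defs "HOL-Combinatorics.Permutations"
begin

text \<open>
  Call the support of a pair \<open>(P, Q)\<close> the set of positions of \<open>P\<close> and of \<open>Q\<close> with a nonzero entry.
  A pointed cone cut out by nonnegativity of entries is generated by any family \<open>G\<close> of its elements
  such that the support of every nonzero element contains that of some member of \<open>G\<close>: subtract the
  largest admissible multiple of that member, which kills an entry, and iterate. If moreover the
  supports of the members of \<open>G\<close> form an antichain, they generate exactly the extremal rays.

  Since \<open>K = J/2 - I\<close> with \<open>J\<close> the all-ones matrix, \<open>Q = KPK\<close> reads
  \<open>Q\<^sub>a\<^sub>b - P\<^sub>a\<^sub>b = s/4 - (r\<^sub>a + c\<^sub>b)/2\<close>, where \<open>r\<close>, \<open>c\<close>, \<open>s\<close> are the row sums, column sums and total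
  of \<open>P\<close>. Sorting rows and columns by their sums makes these differences monotone, and the existence of
  a box, diagonal or cross below a given support becomes a finite problem of linear arithmetic.
\<close>

section \<open>Cones cut out by nonnegative linear functionals\<close>

lemma ray_scaleR:
  assumes "t > 0"
  shows "ray (t *\<^sub>R x) = ray x"
proof
  have "s *\<^sub>R t *\<^sub>R x = (s * t) *\<^sub>R x" "s \<ge> 0 \<Longrightarrow> s * t \<ge> 0" for s
    using assms by simp_all
  then show "ray (t *\<^sub>R x) \<subseteq> ray x"
    unfolding ray_def by blast
  have "s *\<^sub>R x = (s / t) *\<^sub>R t *\<^sub>R x" "s \<ge> 0 \<Longrightarrow> s / t \<ge> 0" for s
    using assms by simp_all
  then show "ray x \<subseteq> ray (t *\<^sub>R x)"
    unfolding ray_def by blast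
qed

text \<open>\<open>diff_in\<close> expresses that \<open>C\<close> is the part of a linear subspace
  where all \<open>f e\<close> are nonnegative, without naming the subspace.
  \<open>f_faithful\<close> makes the cone pointed.\<close>

locale cone_with_functionals =
  fixes C :: "'a::real_vector set" and f :: "'e::finite \<Rightarrow> 'a \<Rightarrow> real" and G :: "'a set"
  assumes linear_f: "\<And>e. linear (f e)"
    and cone: "convex_cone C"
    and f_nonneg: "\<And>x e. x \<in> C \<Longrightarrow> 0 \<le> f e x"
    and diff_in: "\<And>x y. x \<in> C \<Longrightarrow> y \<in> C \<Longrightarrow> (\<And>e. f e y \<le> f e x) \<Longrightarrow> x - y \<in> C"
    and f_faithful: "\<And>x. x \<in> C \<Longrightarrow> (\<And>e. f e x = 0) \<Longrightarrow> x = 0"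
    and G_subset: "G \<subseteq> C"
    and G_nonzero: "0 \<notin> G"
    and G_below: "\<And>x. x \<in> C \<Longrightarrow> x \<noteq> 0 \<Longrightarrow> \<exists>g\<in>G. \<forall>e. f e x = 0 \<longrightarrow> f e g = 0"
begin

definition supp :: "'a \<Rightarrow> 'e set" where
  "supp x = {e. f e x \<noteq> 0}"

lemma G_below_supp: "x \<in> C \<Longrightarrow> x \<noteq> 0 \<Longrightarrow> \<exists>g\<in>G. supp g \<subseteq> supp x"
  using G_below unfolding supp_def by blast

lemma f_diff_scaleR: "f e (x - t *\<^sub>R g) = f e x - t * f e g"
  using linear_f[of e] by (simp add: linear_diff linear_scale)

text \<open>A ratio test: \<open>t\<close> is the least quotient \<open>f e x / f e g\<close> over
  the support of \<open>g\<close>. No functional becomes negative, and the one attaining the minimum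
  becomes zero.\<close>

lemma peel:
  assumes x: "x \<in> C" and g: "g \<in> C" "g \<noteq> 0" and sub: "supp g \<subseteq> supp x"
  obtains t where "t > 0" "x - t *\<^sub>R g \<in> C" "supp (x - t *\<^sub>R g) \<subset> supp x"
proof -
  define t where "t = Min ((\<lambda>e. f e x / f e g) ` supp g)"
  have ne: "supp g \<noteq> {}"
    using g f_faithful unfolding supp_def by blast
  have fin: "finite ((\<lambda>e. f e x / f e g) ` supp g)"
    by simp
  have pos: "f e g > 0" "f e x > 0" if "e \<in> supp g" for e
    using that sub f_nonneg[OF x, of e] f_nonneg[OF g(1), of e]
    unfolding supp_def by (auto simp: order_less_le)
  have t_pos: "t > 0"
    unfolding t_def using fin ne pos by (subst Min_gr_iff) auto
  have le: "t * f e g \<le> f e x" for e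
  proof (cases "e \<in> supp g")
    case True
    then have "t \<le> f e x / f e g"
      unfolding t_def using fin by (intro Min_le) auto
    then show ?thesis
      using pos[OF True] by (simp add: field_simps)
  next
    case False
    then show ?thesis
      using f_nonneg[OF x] by (simp add: supp_def)
  qed
  obtain e where e: "e \<in> supp g" "t = f e x / f e g"
    using Min_in[OF fin] ne unfolding t_def by blast
  then have "f e (x - t *\<^sub>R g) = 0"
    using pos[OF e(1)] by (simp add: f_diff_scaleR)
  then have "e \<notin> supp (x - t *\<^sub>R g)" "e \<in> supp x"
    using e sub by (auto simp: supp_def)
  moreover have "supp (x - t *\<^sub>R g) \<subseteq> supp x"
    using sub unfolding supp_def f_diff_scaleR by auto
  moreover have "x - t *\<^sub>R g \<in> C"
  proof (rule diff_in[OF x])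
    show "t *\<^sub>R g \<in> C"
      using convex_cone_scaleR[OF cone] t_pos g by simp
    show "f e (t *\<^sub>R g) \<le> f e x" for e
      using le[of e] linear_f[of e] by (simp add: linear_scale)
  qed
  ultimately show ?thesis
    using that[OF t_pos] by blast
qed

lemma eq_convex_cone_hull: "C = convex_cone hull G"
proof
  show "convex_cone hull G \<subseteq> C"
    by (rule hull_minimal) (use G_subset cone in auto)
  show "C \<subseteq> convex_cone hull G"
  proof
    fix x assume "x \<in> C"
    then show "x \<in> convex_cone hull G"
    proof (induction "card (supp x)" arbitrary: x rule: less_induct)
      case less
      show ?case
      proof (cases "x = 0")
        case True
        then show ?thesis by (simp add: convex_cone_hull_contains_0)
      next
        case False
        then obtain g where g: "g \<in> G" "supp g \<subseteq> supp x"
          using G_below_supp less.prems by blast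
        have gC: "g \<in> C" "g \<noteq> 0"
          using g G_subset G_nonzero by auto
        obtain t where t: "t > 0" "x - t *\<^sub>R g \<in> C" "supp (x - t *\<^sub>R g) \<subset> supp x"
          using peel[OF less.prems gC g(2)] .
        have "x - t *\<^sub>R g \<in> convex_cone hull G"
          using less.hyps[OF _ t(2)] t(3) by (simp add: psubset_card_mono)
        moreover have "t *\<^sub>R g \<in> convex_cone hull G"
          using g t by (intro convex_cone_hull_mul) (auto intro: hull_inc)
        ultimately show ?thesis
          using convex_cone_hull_add by fastforce
      qed
    qed
  qed
qed

text \<open>By minimality every nonzero element of \<open>C\<close> supported inside
  \<open>supp g\<close> has exactly that support. Peeling \<open>g\<close> off \<open>w\<close>
  makes the support strictly smaller, so the remainder must vanish.\<close>

lemma in_ray_of_supp_subset: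
  assumes g: "g \<in> G" and minimal: "\<And>h. h \<in> G \<Longrightarrow> supp h \<subseteq> supp g \<Longrightarrow> h = g"
    and w: "w \<in> C" "supp w \<subseteq> supp g"
  shows "w \<in> ray g"
proof (cases "w = 0")
  case True
  then show ?thesis unfolding ray_def by force
next
  case False
  have gC: "g \<in> C" "g \<noteq> 0"
    using g G_subset G_nonzero by auto
  have le: "supp g \<subseteq> supp v" if "v \<in> C" "v \<noteq> 0" "supp v \<subseteq> supp g" for v
    using G_below_supp[OF that(1,2)] minimal that(3) by blast
  obtain t where t: "t > 0" "w - t *\<^sub>R g \<in> C" "supp (w - t *\<^sub>R g) \<subset> supp w"
    using peel[OF w(1) gC le[OF w(1) False w(2)]] .
  then have "w - t *\<^sub>R g = 0"
    using le[OF t(2)] w(2) by blast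
  then show ?thesis
    using t(1) unfolding ray_def by auto
qed

end

locale antichain_cone = cone_with_functionals +
  assumes antichain: "\<And>g h. g \<in> G \<Longrightarrow> h \<in> G \<Longrightarrow> supp h \<subseteq> supp g \<Longrightarrow> h = g"
begin

text \<open>Nonnegative values cannot cancel, so both summands of \<open>g\<close> are supported
  inside \<open>supp g\<close>.\<close>

lemma extreme_ray_gen_G:
  assumes g: "g \<in> G"
  shows "extreme_ray_gen C g"
  unfolding extreme_ray_gen_def
proof (intro conjI allI impI)
  fix y z assume y: "y \<in> C" and z: "z \<in> C" and sum: "y + z = g"
  have "f e y + f e z = f e g" for e
    using linear_f[of e] sum by (metis linear_add)
  then have "supp y \<subseteq> supp g" "supp z \<subseteq> supp g"
    using f_nonneg[OF y] f_nonneg[OF z] unfolding supp_def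
    by (smt (verit) Collect_mono)+
  then show "y \<in> ray g" "z \<in> ray g"
    using in_ray_of_supp_subset[OF g] antichain[OF g] y z by blast+
qed (use g G_subset G_nonzero in auto)

text \<open>For an extreme \<open>x\<close>, peel off a generator \<open>g\<close> below it:
  \<open>t *\<^sub>R g\<close> is a summand of \<open>x\<close> and hence lies on its ray, so the
  two rays coincide.\<close>

lemma extremal_rays_eq: "extremal_rays C = ray ` G"
proof
  show "ray ` G \<subseteq> extremal_rays C"
    using extreme_ray_gen_G unfolding extremal_rays_def by blast
  show "extremal_rays C \<subseteq> ray ` G"
  proof
    fix R assume "R \<in> extremal_rays C"
    then obtain x where R: "R = ray x" and x: "extreme_ray_gen C x"
      unfolding extremal_rays_def by blast
    then have xC: "x \<in> C" "x \<noteq> 0"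
      unfolding extreme_ray_gen_def by auto
    then obtain g where g: "g \<in> G" "supp g \<subseteq> supp x"
      using G_below_supp by blast
    have gC: "g \<in> C" "g \<noteq> 0"
      using g G_subset G_nonzero by auto
    obtain t where t: "t > 0" "x - t *\<^sub>R g \<in> C"
      using peel[OF xC(1) gC g(2)] by blast
    have "t *\<^sub>R g \<in> C"
      using convex_cone_scaleR[OF cone] t gC by simp
    then have "t *\<^sub>R g \<in> ray x"
      using x t(2) unfolding extreme_ray_gen_def by (metis add.commute diff_add_cancel)
    then obtain u where u: "u \<ge> 0" "t *\<^sub>R g = u *\<^sub>R x"
      unfolding ray_def by auto
    then have "u > 0"
      using t(1) gC by (cases "u = 0") auto
    then have "ray x = ray g"
      using u ray_scaleR t(1) by metis
    then show "R \<in> ray ` G"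
      using R g by blast
  qed
qed

lemma inj_on_ray: "inj_on ray G"
proof
  fix g h assume gh: "g \<in> G" "h \<in> G" and eq: "ray g = ray h"
  have "g \<in> ray g"
    unfolding ray_def by (auto intro: exI[of _ 1])
  then obtain t where t: "g = t *\<^sub>R h"
    using eq unfolding ray_def by auto
  then have "supp g \<subseteq> supp h"
    using linear_f by (auto simp: supp_def linear_scale)
  then show "g = h"
    using antichain gh by blast
qed

end

section \<open>Coordinates for the cone and for the crosses\<close>

lemma Kmat_mult_nth:
  "(Kmat ** P) $ a $ b = (\<Sum>i\<in>UNIV. P $ i $ b) / 2 - P $ a $ b"
  "(P ** Kmat) $ a $ b = (\<Sum>j\<in>UNIV. P $ a $ j) / 2 - P $ a $ b"
proof -
  have K: "Kmat $ i $ j * x = x / 2 - (if j = i then x else 0)"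
    "x * Kmat $ i $ j = x / 2 - (if i = j then x else 0)" for i j x
    by (simp_all add: Kmat_def)
  show "(Kmat ** P) $ a $ b = (\<Sum>i\<in>UNIV. P $ i $ b) / 2 - P $ a $ b"
    by (simp add: matrix_matrix_mult_def K sum_subtractf sum_divide_distrib)
  show "(P ** Kmat) $ a $ b = (\<Sum>j\<in>UNIV. P $ a $ j) / 2 - P $ a $ b"
    by (simp add: matrix_matrix_mult_def K sum_subtractf sum_divide_distrib)
qed

text \<open>The factor 4 clears the denominators that come from the two factors J/2 - I.\<close>

lemma Kmat_conj_nth:
  "4 * (Kmat ** P ** Kmat) $ a $ b
    = 4 * P $ a $ b + (\<Sum>i\<in>UNIV. \<Sum>j\<in>UNIV. P $ i $ j)
      - 2 * (\<Sum>j\<in>UNIV. P $ a $ j) - 2 * (\<Sum>i\<in>UNIV. P $ i $ b)"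
proof -
  have "(\<Sum>j\<in>UNIV. \<Sum>i\<in>UNIV. P $ i $ j) = (\<Sum>i\<in>UNIV. \<Sum>j\<in>UNIV. P $ i $ j)"
    by (rule sum.swap)
  then show ?thesis
    by (simp add: Kmat_mult_nth sum_subtractf flip: sum_divide_distrib)
qed

lemma S2_iff:
  "(P, Q) \<in> S2 \<longleftrightarrow> (\<forall>a b. 0 \<le> P $ a $ b) \<and> (\<forall>a b. 0 \<le> Q $ a $ b) \<and>
    (\<forall>a b. 4 * Q $ a $ b = 4 * P $ a $ b + (\<Sum>i\<in>UNIV. \<Sum>j\<in>UNIV. P $ i $ j)
      - 2 * (\<Sum>j\<in>UNIV. P $ a $ j) - 2 * (\<Sum>i\<in>UNIV. P $ i $ b))"
proof -
  have "Kmat ** P ** Kmat = Q \<longleftrightarrow> (\<forall>a b. 4 * Q $ a $ b = 4 * (Kmat ** P ** Kmat) $ a $ b)"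
    by (auto simp: vec_eq_iff)
  then show ?thesis
    unfolding S2_def nonneg_mat_def Kmat_conj_nth by auto
qed

text \<open>\<open>U\<^sub>\<sigma> P\<^sub>3 U\<^sub>\<tau>\<close> depends only on the permutation \<open>\<pi> = \<sigma> \<circ> \<tau>\<close> and on the column \<open>j = \<tau>\<inverse> 4\<close> that it
  annihilates; its row \<open>\<pi> j\<close> is the one with three ones. This gives the count \<open>2 \<sqdot> 24 \<sqdot> 4 = 192\<close>.\<close>

definition cross_row :: "(4 \<Rightarrow> 4) \<Rightarrow> 4 \<Rightarrow> mat4" where
  "cross_row \<pi> j = (\<chi> a b. if b \<noteq> j \<and> (a = \<pi> b \<or> a = \<pi> j) then 1 else 0)"

definition cross_col :: "(4 \<Rightarrow> 4) \<Rightarrow> 4 \<Rightarrow> mat4" where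
  "cross_col \<pi> j = (\<chi> a b. if a \<noteq> \<pi> j \<and> (a = \<pi> b \<or> b = j) then 1 else 0)"

lemma perm_mat_conj_nth:
  assumes "\<sigma> permutes UNIV"
  shows "(perm_mat \<sigma> ** M ** perm_mat \<tau>) $ a $ b = M $ inv \<sigma> a $ \<tau> b"
proof -
  have "(\<sigma> k = a) = (k = inv \<sigma> a)" for k
    using permutes_inverses[OF assms] by metis
  then show ?thesis
    by (simp add: matrix_matrix_mult_def perm_mat_def if_distrib if_distribR cong: if_cong)
qed

lemma perm_mat_P3:
  assumes "\<sigma> permutes UNIV" "\<tau> permutes UNIV"
  shows "perm_mat \<sigma> ** P3 ** perm_mat \<tau> = cross_row (\<sigma> \<circ> \<tau>) (inv \<tau> 4)"
    and "perm_mat \<sigma> ** transpose P3 ** perm_mat \<tau> = cross_col (\<sigma> \<circ> \<tau>) (inv \<tau> 4)"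
proof -
  have inv_eq: "inv \<sigma> a = k \<longleftrightarrow> a = \<sigma> k" "b = inv \<tau> k \<longleftrightarrow> \<tau> b = k" "\<tau> (inv \<tau> k) = k"
      "\<sigma> (inv \<sigma> k) = k" "inv \<sigma> (\<sigma> k) = k" for a b k
    using permutes_inverses[OF assms(1)] permutes_inverses[OF assms(2)] by metis+
  show "perm_mat \<sigma> ** P3 ** perm_mat \<tau> = cross_row (\<sigma> \<circ> \<tau>) (inv \<tau> 4)"
    unfolding vec_eq_iff perm_mat_conj_nth[OF assms(1)]
    by (auto simp: P3_def cross_row_def inv_eq)
  show "perm_mat \<sigma> ** transpose P3 ** perm_mat \<tau> = cross_col (\<sigma> \<circ> \<tau>) (inv \<tau> 4)"
    unfolding vec_eq_iff perm_mat_conj_nth[OF assms(1)]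
    by (auto simp: P3_def transpose_def cross_col_def inv_eq)
qed

abbreviation permutations :: "(4 \<Rightarrow> 4) set" where
  "permutations \<equiv> {\<pi>. \<pi> permutes UNIV}"

lemma compose_permutations_image:
  "(\<lambda>(\<sigma>, \<tau>). (\<sigma> \<circ> \<tau>, inv \<tau> 4)) ` (permutations \<times> permutations) = permutations \<times> UNIV"
proof (intro equalityI subsetI)
  fix p assume "p \<in> permutations \<times> (UNIV :: 4 set)"
  then obtain \<pi> j where p: "p = (\<pi>, j)" "\<pi> permutes UNIV" by auto
  \<comment> \<open>This transposition is an involution sending 4 to \<open>j\<close>, so composing
    \<open>\<pi>\<close> with it twice gives back \<open>\<pi>\<close>.\<close>
  let ?\<tau> = "Transposition.transpose j 4"
  have \<tau>: "?\<tau> permutes UNIV"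
    by (simp add: permutes_swap_id)
  have "(\<lambda>(\<sigma>, \<tau>). (\<sigma> \<circ> \<tau>, inv \<tau> 4)) (\<pi> \<circ> ?\<tau>, ?\<tau>) = p"
    by (simp add: p(1) comp_assoc)
  moreover have "(\<pi> \<circ> ?\<tau>) permutes UNIV"
    using \<tau> p(2) by (rule permutes_compose)
  ultimately show "p \<in> (\<lambda>(\<sigma>, \<tau>). (\<sigma> \<circ> \<tau>, inv \<tau> 4)) ` (permutations \<times> permutations)"
    using \<tau> by (intro image_eqI[where x = "(\<pi> \<circ> ?\<tau>, ?\<tau>)"]) auto
qed (auto intro: permutes_compose)

lemma crosses_eq:
  "crosses = (\<lambda>(\<pi>, j). (cross_row \<pi> j, cross_col \<pi> j)) ` (permutations \<times> UNIV)
    \<union> (\<lambda>(\<pi>, j). (cross_col \<pi> j, cross_row \<pi> j)) ` (permutations \<times> UNIV)"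
proof -
  have "crosses =
    (\<lambda>(\<sigma>, \<tau>). (perm_mat \<sigma> ** P3 ** perm_mat \<tau>, perm_mat \<sigma> ** transpose P3 ** perm_mat \<tau>))
      ` (permutations \<times> permutations) \<union>
    (\<lambda>(\<sigma>, \<tau>). (perm_mat \<sigma> ** transpose P3 ** perm_mat \<tau>, perm_mat \<sigma> ** P3 ** perm_mat \<tau>))
      ` (permutations \<times> permutations)"
    unfolding crosses_def by fast
  \<comment> \<open>The indexing now factors through the map of
    \<open>compose_permutations_image\<close>, which allows its image to replace the domain.\<close>
  also have "\<dots> = (\<lambda>p. case (\<lambda>(\<sigma>, \<tau>). (\<sigma> \<circ> \<tau>, inv \<tau> 4)) p of (\<pi>, j) \<Rightarrow> (cross_row \<pi> j, cross_col \<pi> j))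
      ` (permutations \<times> permutations) \<union>
    (\<lambda>p. case (\<lambda>(\<sigma>, \<tau>). (\<sigma> \<circ> \<tau>, inv \<tau> 4)) p of (\<pi>, j) \<Rightarrow> (cross_col \<pi> j, cross_row \<pi> j))
      ` (permutations \<times> permutations)"
    by (intro arg_cong2[of _ _ _ _ "(\<union>)"] image_cong) (auto simp: perm_mat_P3)
  finally show ?thesis
    unfolding compose_permutations_image[symmetric] image_image .
qed

section \<open>Line sums of the generators and their membership in the cone\<close>

lemma sum_indicator_card: "(\<Sum>x\<in>UNIV. if R x then 1 else 0) = real (card {x::4. R x})"
  by (simp add: sum.If_cases)

lemma sum_if_mem: "(\<Sum>i\<in>UNIV. if i \<in> A then x else 0) = card A * x" for A :: "4 set" and x :: real
  by (simp add: sum.If_cases)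

lemma card_Compl_singleton: "card (- {x :: 4}) = 3"
  by (simp add: Compl_eq_Diff_UNIV card_Diff_singleton)

lemma sum_if_eq: "(\<Sum>i\<in>UNIV. if i = k then x else y) = x + 3 * y" for k :: 4 and x y :: real
  by (simp add: sum.If_cases card_Compl_singleton)

lemma box_mat_sums:
  "(\<Sum>j\<in>UNIV. box_mat A B $ a $ j) = (if a \<in> A then real (card B) else 0)"
  "(\<Sum>i\<in>UNIV. box_mat A B $ i $ b) = (if b \<in> B then real (card A) else 0)"
  by (simp_all add: box_mat_def sum_indicator_card)

lemma perm_mat_sums:
  assumes "\<pi> permutes UNIV"
  shows "(\<Sum>j\<in>UNIV. perm_mat \<pi> $ a $ j) = 1" "(\<Sum>i\<in>UNIV. perm_mat \<pi> $ i $ b) = 1"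
proof -
  have "(\<pi> j = a) = (j = inv \<pi> a)" for j a
    using permutes_inverses[OF assms] by metis
  then show "(\<Sum>j\<in>UNIV. perm_mat \<pi> $ a $ j) = 1" for a
    by (simp add: perm_mat_def)
qed (simp add: perm_mat_def)

lemma cross_row_nth: "cross_row \<pi> j $ a $ b = (if b \<noteq> j \<and> (a = \<pi> b \<or> a = \<pi> j) then 1 else 0)"
  by (simp add: cross_row_def)

lemma cross_col_nth: "cross_col \<pi> j $ a $ b = (if a \<noteq> \<pi> j \<and> (a = \<pi> b \<or> b = j) then 1 else 0)"
  by (simp add: cross_col_def)

lemma cross_sums:
  assumes "\<pi> permutes UNIV"
  shows "(\<Sum>b\<in>UNIV. cross_row \<pi> j $ a $ b) = (if a = \<pi> j then 3 else 1)"
    "(\<Sum>a\<in>UNIV. cross_row \<pi> j $ a $ b) = (if b = j then 0 else 2)"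
    "(\<Sum>b\<in>UNIV. cross_col \<pi> j $ a $ b) = (if a = \<pi> j then 0 else 2)"
    "(\<Sum>a\<in>UNIV. cross_col \<pi> j $ a $ b) = (if b = j then 3 else 1)"
proof -
  have inj: "\<pi> x = \<pi> y \<longleftrightarrow> x = y" for x y
    using permutes_inj[OF assms] by (simp add: inj_eq)
  obtain c where c: "a = \<pi> c"
    using permutes_surj[OF assms] by (metis surjD)
  \<comment> \<open>The positions of the ones in a given row or column, where \<open>c\<close> is
    the preimage of \<open>a\<close> under \<open>\<pi>\<close>.\<close>
  have sets: "{b. b \<noteq> j \<and> (a = \<pi> b \<or> a = \<pi> j)} = (if a = \<pi> j then - {j} else {c})"
    "{a. b \<noteq> j \<and> (a = \<pi> b \<or> a = \<pi> j)} = (if b = j then {} else {\<pi> b, \<pi> j})"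
    "{b. a \<noteq> \<pi> j \<and> (a = \<pi> b \<or> b = j)} = (if a = \<pi> j then {} else {c, j})"
    "{a. a \<noteq> \<pi> j \<and> (a = \<pi> b \<or> b = j)} = (if b = j then - {\<pi> j} else {\<pi> b})" for b
    by (auto simp: c inj)
  show "(\<Sum>b\<in>UNIV. cross_row \<pi> j $ a $ b) = (if a = \<pi> j then 3 else 1)"
    and "(\<Sum>a\<in>UNIV. cross_row \<pi> j $ a $ b) = (if b = j then 0 else 2)"
    and "(\<Sum>b\<in>UNIV. cross_col \<pi> j $ a $ b) = (if a = \<pi> j then 0 else 2)"
    and "(\<Sum>a\<in>UNIV. cross_col \<pi> j $ a $ b) = (if b = j then 3 else 1)"
    unfolding cross_row_nth cross_col_nth sum_indicator_card sets
    by (auto simp: card_Compl_singleton inj c)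
qed

text \<open>Write u, v for the indicators of \<open>A\<close>, \<open>B\<close>. The line sums are
  2u and 2v and the total is 4, so the formula gives uv + 1 - u - v = (1 - u)(1 - v), the box of the
  complements.\<close>

lemma boxes_subset_S2: "boxes \<subseteq> S2"
proof -
  have "(box_mat A B, box_mat (- A) (- B)) \<in> S2" if "card A = 2" "card B = 2" for A B
    unfolding S2_iff box_mat_sums sum_if_mem that by (simp add: box_mat_def)
  then show ?thesis
    unfolding boxes_def by blast
qed

text \<open>All line sums are 1 and the total is 4, so the correction 4 - 2 - 2 vanishes.\<close>

lemma diagonals_subset_S2: "diagonals \<subseteq> S2"
  unfolding diagonals_def by (auto simp: S2_iff perm_mat_sums) (simp_all add: perm_mat_def)

text \<open>For \<open>cross_row\<close> the total is 6, and the correction 6 - 2r - 2c is -4 on row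
  \<open>\<pi> j\<close> outside column \<open>j\<close>, 4 on column \<open>j\<close> outside that
  row, and 0 elsewhere: three ones move from the row to the column. For \<open>cross_col\<close>
  they move back.\<close>

lemma crosses_subset_S2: "crosses \<subseteq> S2"
proof -
  have "(cross_row \<pi> j, cross_col \<pi> j) \<in> S2 \<and> (cross_col \<pi> j, cross_row \<pi> j) \<in> S2"
    if \<pi>: "\<pi> permutes UNIV" for \<pi> j
  proof -
    have inj: "\<pi> x = \<pi> y \<longleftrightarrow> x = y" for x y
      using permutes_inj[OF \<pi>] by (simp add: inj_eq)
    show ?thesis
      unfolding S2_iff cross_sums[OF \<pi>] sum_if_eq
      by (auto simp: cross_row_nth cross_col_nth inj)
  qed
  then show ?thesis
    unfolding crosses_eq by auto
qed

section \<open>A generator below every nonzero element of the cone\<close>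

text \<open>The assumptions \<open>box\<close>, \<open>diag\<close>, \<open>row\<close> and \<open>col\<close> say that no generator has its support inside that
  of \<open>(p, q)\<close>. Once rows and columns are sorted, the 68 instances listed in the proof, an
  inclusion-minimal selection out of the 252, already contradict the linear constraints.\<close>

lemma no_sorted_blocked:
  fixes p q :: "'r \<Rightarrow> 'c \<Rightarrow> real"
  assumes rows: "distinct [a1, a2, a3, a4]" and cols: "distinct [b1, b2, b3, b4]"
    and nonneg: "\<And>a b. 0 \<le> p a b" "\<And>a b. 0 \<le> q a b"
    and q: "\<And>a b. 4 * q a b = 4 * p a b + s - 2 * r a - 2 * c b"
    and r: "\<And>a. r a = p a b1 + p a b2 + p a b3 + p a b4"
    and c: "\<And>b. c b = p a1 b + p a2 b + p a3 b + p a4 b"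
    and s: "s = r a1 + r a2 + r a3 + r a4" "s > 0"
    and sorted: "r a2 \<le> r a1" "r a3 \<le> r a2" "r a4 \<le> r a3"
      "c b2 \<le> c b1" "c b3 \<le> c b2" "c b4 \<le> c b3"
    and box: "\<And>a a' d d' b b' e e'. distinct [a, a', d, d'] \<Longrightarrow> distinct [b, b', e, e'] \<Longrightarrow>
      p a b = 0 \<or> p a b' = 0 \<or> p a' b = 0 \<or> p a' b' = 0 \<or>
      q d e = 0 \<or> q d e' = 0 \<or> q d' e = 0 \<or> q d' e' = 0"
    and diag: "\<And>x1 x2 x3 x4 y1 y2 y3 y4. distinct [x1, x2, x3, x4] \<Longrightarrow> distinct [y1, y2, y3, y4] \<Longrightarrow>
      p x1 y1 = 0 \<or> p x2 y2 = 0 \<or> p x3 y3 = 0 \<or> p x4 y4 = 0 \<or>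
      q x1 y1 = 0 \<or> q x2 y2 = 0 \<or> q x3 y3 = 0 \<or> q x4 y4 = 0"
    and row: "\<And>x x1 x2 x3 y y1 y2 y3. distinct [x, x1, x2, x3] \<Longrightarrow> distinct [y, y1, y2, y3] \<Longrightarrow>
      p x y1 = 0 \<or> p x y2 = 0 \<or> p x y3 = 0 \<or> p x1 y1 = 0 \<or> p x2 y2 = 0 \<or> p x3 y3 = 0 \<or>
      q x1 y = 0 \<or> q x2 y = 0 \<or> q x3 y = 0 \<or> q x1 y1 = 0 \<or> q x2 y2 = 0 \<or> q x3 y3 = 0"
    and col: "\<And>x x1 x2 x3 y y1 y2 y3. distinct [x, x1, x2, x3] \<Longrightarrow> distinct [y, y1, y2, y3] \<Longrightarrow>
      p x1 y = 0 \<or> p x2 y = 0 \<or> p x3 y = 0 \<or> p x1 y1 = 0 \<or> p x2 y2 = 0 \<or> p x3 y3 = 0 \<or>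
      q x y1 = 0 \<or> q x y2 = 0 \<or> q x y3 = 0 \<or> q x1 y1 = 0 \<or> q x2 y2 = 0 \<or> q x3 y3 = 0"
  shows False
proof -
  have [simp]: "a1 \<noteq> a2" "a1 \<noteq> a3" "a1 \<noteq> a4" "a2 \<noteq> a3" "a2 \<noteq> a4" "a3 \<noteq> a4"
    "b1 \<noteq> b2" "b1 \<noteq> b3" "b1 \<noteq> b4" "b2 \<noteq> b3" "b2 \<noteq> b4" "b3 \<noteq> b4"
    "a2 \<noteq> a1" "a3 \<noteq> a1" "a4 \<noteq> a1" "a3 \<noteq> a2" "a4 \<noteq> a2" "a4 \<noteq> a3"
    "b2 \<noteq> b1" "b3 \<noteq> b1" "b4 \<noteq> b1" "b3 \<noteq> b2" "b4 \<noteq> b2" "b4 \<noteq> b3"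
    using rows cols by auto
  \<comment> \<open>The selection consists of 8 boxes, all 24 diagonals, 15 crosses with a full row
    in \<open>p\<close> and 21 with a full column. Since p - q = (r + c)/2 - s/4 decreases along the
    ordering, the chosen boxes have row \<open>a1\<close> in \<open>p\<close>, the full rows are
    among \<open>a1\<close>, \<open>a2\<close>, \<open>a3\<close>, and the full columns among
    \<open>b1\<close>, \<open>b2\<close>, \<open>b3\<close>.\<close>
  note blocked =
    box[of a1 a2 a3 a4 b1 b2 b3 b4] box[of a1 a2 a3 a4 b1 b3 b2 b4]
    box[of a1 a2 a3 a4 b2 b3 b1 b4] box[of a1 a3 a2 a4 b1 b2 b3 b4]
    box[of a1 a3 a2 a4 b1 b3 b2 b4] box[of a1 a3 a2 a4 b2 b3 b1 b4]
    box[of a1 a4 a2 a3 b1 b2 b3 b4] box[of a1 a4 a2 a3 b1 b3 b2 b4]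
    diag[of a1 a2 a3 a4 b1 b2 b3 b4] diag[of a1 a2 a3 a4 b1 b2 b4 b3]
    diag[of a1 a2 a3 a4 b1 b3 b2 b4] diag[of a1 a2 a3 a4 b1 b3 b4 b2]
    diag[of a1 a2 a3 a4 b1 b4 b2 b3] diag[of a1 a2 a3 a4 b1 b4 b3 b2]
    diag[of a1 a2 a3 a4 b2 b1 b3 b4] diag[of a1 a2 a3 a4 b2 b1 b4 b3]
    diag[of a1 a2 a3 a4 b2 b3 b1 b4] diag[of a1 a2 a3 a4 b2 b3 b4 b1]
    diag[of a1 a2 a3 a4 b2 b4 b1 b3] diag[of a1 a2 a3 a4 b2 b4 b3 b1]
    diag[of a1 a2 a3 a4 b3 b1 b2 b4] diag[of a1 a2 a3 a4 b3 b1 b4 b2]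
    diag[of a1 a2 a3 a4 b3 b2 b1 b4] diag[of a1 a2 a3 a4 b3 b2 b4 b1]
    diag[of a1 a2 a3 a4 b3 b4 b1 b2] diag[of a1 a2 a3 a4 b3 b4 b2 b1]
    diag[of a1 a2 a3 a4 b4 b1 b2 b3] diag[of a1 a2 a3 a4 b4 b1 b3 b2]
    diag[of a1 a2 a3 a4 b4 b2 b1 b3] diag[of a1 a2 a3 a4 b4 b2 b3 b1]
    diag[of a1 a2 a3 a4 b4 b3 b1 b2] diag[of a1 a2 a3 a4 b4 b3 b2 b1]
    row[of a1 a2 a3 a4 b2 b1 b3 b4] row[of a1 a2 a3 a4 b2 b3 b4 b1]
    row[of a1 a2 a3 a4 b2 b4 b3 b1] row[of a1 a2 a3 a4 b4 b1 b2 b3]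
    row[of a1 a2 a3 a4 b4 b1 b3 b2] row[of a1 a2 a3 a4 b4 b2 b1 b3]
    row[of a1 a2 a3 a4 b4 b2 b3 b1] row[of a1 a2 a3 a4 b4 b3 b1 b2]
    row[of a1 a2 a3 a4 b4 b3 b2 b1] row[of a2 a1 a3 a4 b4 b1 b3 b2]
    row[of a2 a1 a3 a4 b4 b2 b1 b3] row[of a2 a1 a3 a4 b4 b3 b2 b1]
    row[of a3 a1 a2 a4 b4 b1 b2 b3] row[of a3 a1 a2 a4 b4 b1 b3 b2]
    row[of a3 a1 a2 a4 b4 b3 b1 b2] col[of a2 a1 a3 a4 b1 b2 b3 b4]
    col[of a2 a1 a3 a4 b1 b3 b4 b2] col[of a2 a1 a3 a4 b1 b4 b2 b3]
    col[of a3 a1 a2 a4 b1 b2 b3 b4] col[of a3 a1 a2 a4 b1 b2 b4 b3]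
    col[of a3 a1 a2 a4 b1 b3 b2 b4] col[of a4 a1 a2 a3 b1 b2 b3 b4]
    col[of a4 a1 a2 a3 b1 b2 b4 b3] col[of a4 a1 a2 a3 b1 b3 b2 b4]
    col[of a4 a1 a2 a3 b1 b3 b4 b2] col[of a4 a1 a2 a3 b1 b4 b2 b3]
    col[of a4 a1 a2 a3 b1 b4 b3 b2] col[of a4 a1 a2 a3 b2 b3 b1 b4]
    col[of a4 a1 a2 a3 b2 b3 b4 b1] col[of a4 a1 a2 a3 b2 b4 b3 b1]
    col[of a4 a1 a2 a3 b3 b1 b2 b4] col[of a4 a1 a2 a3 b3 b1 b4 b2]
    col[of a4 a1 a2 a3 b3 b2 b1 b4] col[of a4 a1 a2 a3 b3 b2 b4 b1]
    col[of a4 a1 a2 a3 b3 b4 b1 b2] col[of a4 a1 a2 a3 b3 b4 b2 b1]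
  \<comment> \<open>Only the sixteen positions in these rows and columns matter; simplification then
    leaves the solver a quantifier-free problem.\<close>
  have linear: "\<forall>a\<in>{a1, a2, a3, a4}. \<forall>b\<in>{b1, b2, b3, b4}.
      0 \<le> p a b \<and> 0 \<le> q a b \<and> 4 * q a b = 4 * p a b + s - 2 * r a - 2 * c b"
    using nonneg q by blast
  show False
    using linear[simplified] r[of a1] r[of a2] r[of a3] r[of a4] c[of b1] c[of b2] c[of b3] c[of b4]
      s sorted blocked[simplified]
     by (smt (z3))
qed

lemma UNIV_4_eq:
  assumes "distinct [a, b, c, d :: 4]"
  shows "UNIV = {a, b, c, d}"
  by (rule card_subset_eq[OF finite subset_UNIV, symmetric]) (use assms in simp)

lemma ex_permutes:
  fixes a b c d e f g h :: 4
  assumes "distinct [a, b, c, d]" "distinct [e, f, g, h]"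
  obtains \<pi> where "\<pi> permutes UNIV" "\<pi> e = a" "\<pi> f = b" "\<pi> g = c" "\<pi> h = d"
proof -
  let ?\<pi> = "\<lambda>x. if x = e then a else if x = f then b else if x = g then c else d"
  have "x = e \<or> x = f \<or> x = g \<or> x = h" for x
    using UNIV_4_eq[OF assms(2)] by blast
  then have inj: "inj ?\<pi>"
    by (intro injI) (use assms in \<open>auto split: if_splits\<close>)
  show ?thesis
  proof (rule that)
    have "bij ?\<pi>"
      using inj finite_UNIV_inj_surj[OF finite inj] by (rule bijI)
    then show "?\<pi> permutes UNIV"
      by (rule bij_imp_permutes) blast
  qed (use assms in auto)
qed

lemma sum_distinct_4:
  assumes "distinct [a, b, c, d :: 4]"
  shows "(\<Sum>i\<in>UNIV. h i) = h a + h b + h c + (h d :: real)"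
  using assms by (subst UNIV_4_eq[OF assms]) simp

lemma obtain_sorted_4:
  fixes h :: "4 \<Rightarrow> real"
  obtains a b c d where "distinct [a, b, c, d]" "h b \<le> h a" "h c \<le> h b" "h d \<le> h c"
proof -
  \<comment> \<open>\<open>sort_key\<close> sorts in ascending order, so the negated key gives
    decreasing values of \<open>h\<close>.\<close>
  define xs where "xs = sort_key (\<lambda>i. - h i) [1, 2, 3, 4 :: 4]"
  have "length xs = 4" "distinct xs" "sorted (map (\<lambda>i. - h i) xs)"
    unfolding xs_def length_sort distinct_sort by (simp, simp, rule sorted_sort_key)
  moreover from this obtain a b c d where "xs = [a, b, c, d]"
    by (auto simp: numeral_eq_Suc length_Suc_conv)
  ultimately show ?thesis
    using that by auto
qed

abbreviation generators :: "(mat4 \<times> mat4) set" where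
  "generators \<equiv> boxes \<union> diagonals \<union> crosses"

text \<open>All 32 coordinates of a pair share one finite index type, as the locale's family of
  functionals requires.\<close>

definition entry :: "bool \<times> 4 \<times> 4 \<Rightarrow> mat4 \<times> mat4 \<Rightarrow> real" where
  "entry = (\<lambda>(k, a, b) x. (if k then fst x else snd x) $ a $ b)"

lemma entry_simps [simp]:
  "entry (True, a, b) (P, Q) = P $ a $ b" "entry (False, a, b) (P, Q) = Q $ a $ b"
  by (simp_all add: entry_def)

lemma all_entries: "(\<forall>e. R e) \<longleftrightarrow> (\<forall>a b. R (True, a, b)) \<and> (\<forall>a b. R (False, a, b))"
  for R :: "bool \<times> 4 \<times> 4 \<Rightarrow> bool"
  by (simp add: split_paired_All all_bool_eq)

text \<open>If no generator fits, each one has a nonzero position where \<open>x\<close> vanishes.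
  Rephrased for arbitrary orderings of rows and columns, these are the blocking assumptions of
  \<open>no_sorted_blocked\<close>, applied with lines sorted by their sums.\<close>

lemma generator_below:
  assumes x: "x \<in> S2" "x \<noteq> 0"
  shows "\<exists>g\<in>generators. \<forall>e. entry e x = 0 \<longrightarrow> entry e g = 0"
proof (rule ccontr)
  assume *: "\<not> ?thesis"
  obtain P Q where PQ: "x = (P, Q)" by fastforce
  have blocked: "(\<exists>a b. P $ a $ b = 0 \<and> X $ a $ b \<noteq> 0) \<or> (\<exists>a b. Q $ a $ b = 0 \<and> Y $ a $ b \<noteq> 0)"
    if "(X, Y) \<in> generators" for X Y
    using * that unfolding all_entries PQ by (metis entry_simps)
  have S2: "0 \<le> P $ a $ b" "0 \<le> Q $ a $ b"
    "4 * Q $ a $ b = 4 * P $ a $ b + (\<Sum>i\<in>UNIV. \<Sum>j\<in>UNIV. P $ i $ j)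
      - 2 * (\<Sum>j\<in>UNIV. P $ a $ j) - 2 * (\<Sum>i\<in>UNIV. P $ i $ b)" for a b
    using x(1) unfolding PQ S2_iff by blast+
  \<comment> \<open>A nonnegative \<open>P\<close> with total 0 is zero, which forces
    \<open>Q = 0\<close> as well.\<close>
  have "(\<Sum>i\<in>UNIV. \<Sum>j\<in>UNIV. P $ i $ j) \<noteq> 0"
  proof
    assume "(\<Sum>i\<in>UNIV. \<Sum>j\<in>UNIV. P $ i $ j) = 0"
    then have "P $ i $ j = 0" for i j
      using S2(1) by (simp add: sum_nonneg_eq_0_iff sum_nonneg)
    then have "P = 0" "Q = 0"
      using S2(3) by (simp_all add: vec_eq_iff)
    then show False
      using x(2) PQ by (simp add: zero_prod_def)
  qed
  moreover have "(\<Sum>i\<in>UNIV. \<Sum>j\<in>UNIV. P $ i $ j) \<ge> 0"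
    using S2(1) by (simp add: sum_nonneg)
  ultimately have pos: "(\<Sum>i\<in>UNIV. \<Sum>j\<in>UNIV. P $ i $ j) > 0"
    by simp
  obtain a1 a2 a3 a4 where rows: "distinct [a1, a2, a3, a4]"
    and r: "(\<Sum>j\<in>UNIV. P $ a2 $ j) \<le> (\<Sum>j\<in>UNIV. P $ a1 $ j)" "(\<Sum>j\<in>UNIV. P $ a3 $ j) \<le> (\<Sum>j\<in>UNIV. P $ a2 $ j)"
      "(\<Sum>j\<in>UNIV. P $ a4 $ j) \<le> (\<Sum>j\<in>UNIV. P $ a3 $ j)"
    by (rule obtain_sorted_4)
  obtain b1 b2 b3 b4 where cols: "distinct [b1, b2, b3, b4]"
    and c: "(\<Sum>i\<in>UNIV. P $ i $ b2) \<le> (\<Sum>i\<in>UNIV. P $ i $ b1)" "(\<Sum>i\<in>UNIV. P $ i $ b3) \<le> (\<Sum>i\<in>UNIV. P $ i $ b2)"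
      "(\<Sum>i\<in>UNIV. P $ i $ b4) \<le> (\<Sum>i\<in>UNIV. P $ i $ b3)"
    by (rule obtain_sorted_4)
  show False
  proof (rule no_sorted_blocked[OF rows cols S2 sum_distinct_4[OF cols] sum_distinct_4[OF rows]
        sum_distinct_4[OF rows] pos r c])
    fix a a' d d' b b' e e' :: 4
    assume d: "distinct [a, a', d, d']" "distinct [b, b', e, e']"
    have compl: "- {a, a'} = {d, d'}" "- {b, b'} = {e, e'}"
      using UNIV_4_eq[OF d(1)] UNIV_4_eq[OF d(2)] d by auto
    have "card {a, a'} = 2" "card {b, b'} = 2"
      using d by auto
    then have "(box_mat {a, a'} {b, b'}, box_mat (- {a, a'}) (- {b, b'})) \<in> generators"
      unfolding boxes_def by blast
    note this[unfolded compl]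
    from blocked[OF this] show "P $ a $ b = 0 \<or> P $ a $ b' = 0 \<or> P $ a' $ b = 0 \<or> P $ a' $ b' = 0 \<or>
      Q $ d $ e = 0 \<or> Q $ d $ e' = 0 \<or> Q $ d' $ e = 0 \<or> Q $ d' $ e' = 0"
      by (auto simp: box_mat_def split: if_splits)
  next
    fix x1 x2 x3 x4 y1 y2 y3 y4 :: 4
    assume d: "distinct [x1, x2, x3, x4]" "distinct [y1, y2, y3, y4]"
    obtain \<pi> where \<pi>: "\<pi> permutes UNIV" "\<pi> y1 = x1" "\<pi> y2 = x2" "\<pi> y3 = x3" "\<pi> y4 = x4"
      using ex_permutes[OF d] .
    then have "(perm_mat \<pi>, perm_mat \<pi>) \<in> generators"
      unfolding diagonals_def by blast
    from blocked[OF this] obtain a b where ab: "P $ a $ b = 0 \<or> Q $ a $ b = 0" "a = \<pi> b"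
      by (auto simp: perm_mat_def split: if_splits)
    have "b \<in> {y1, y2, y3, y4}"
      using UNIV_4_eq[OF d(2)] by blast
    with ab \<pi> show "P $ x1 $ y1 = 0 \<or> P $ x2 $ y2 = 0 \<or> P $ x3 $ y3 = 0 \<or> P $ x4 $ y4 = 0 \<or>
      Q $ x1 $ y1 = 0 \<or> Q $ x2 $ y2 = 0 \<or> Q $ x3 $ y3 = 0 \<or> Q $ x4 $ y4 = 0"
      by auto
  next
    fix x x1 x2 x3 y y1 y2 y3 :: 4
    assume d: "distinct [x, x1, x2, x3]" "distinct [y, y1, y2, y3]"
    \<comment> \<open>One permutation serves both kinds of cross: column \<open>y\<close> and row
      \<open>x = \<pi> y\<close> are the distinguished lines, and the remaining lines are matched by
      \<open>\<pi>\<close>.\<close>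
    obtain \<pi> where \<pi>: "\<pi> permutes UNIV" "\<pi> y = x" "\<pi> y1 = x1" "\<pi> y2 = x2" "\<pi> y3 = x3"
      using ex_permutes[OF d] .
    have b: "b = y \<or> b = y1 \<or> b = y2 \<or> b = y3" for b
      using UNIV_4_eq[OF d(2)] by blast
    have a: "a = x \<or> a = x1 \<or> a = x2 \<or> a = x3" for a
      using UNIV_4_eq[OF d(1)] by blast
    have row: "a = x \<and> (b = y1 \<or> b = y2 \<or> b = y3) \<or> a = x1 \<and> b = y1 \<or> a = x2 \<and> b = y2 \<or> a = x3 \<and> b = y3"
      if "cross_row \<pi> y $ a $ b \<noteq> 0" for a b
      using that b[of b] \<pi>(2-5) by (auto simp: cross_row_nth split: if_splits)
    have col: "b = y \<and> (a = x1 \<or> a = x2 \<or> a = x3) \<or> a = x1 \<and> b = y1 \<or> a = x2 \<and> b = y2 \<or> a = x3 \<and> b = y3"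
      if "cross_col \<pi> y $ a $ b \<noteq> 0" for a b
      using that a[of a] b[of b] \<pi>(2-5) by (auto simp: cross_col_nth split: if_splits)
    have "(cross_row \<pi> y, cross_col \<pi> y) \<in> generators" "(cross_col \<pi> y, cross_row \<pi> y) \<in> generators"
      using \<pi>(1) unfolding crosses_eq by auto
    note * = this[THEN blocked]
    show "P $ x $ y1 = 0 \<or> P $ x $ y2 = 0 \<or> P $ x $ y3 = 0 \<or> P $ x1 $ y1 = 0 \<or> P $ x2 $ y2 = 0 \<or> P $ x3 $ y3 = 0 \<or>
      Q $ x1 $ y = 0 \<or> Q $ x2 $ y = 0 \<or> Q $ x3 $ y = 0 \<or> Q $ x1 $ y1 = 0 \<or> Q $ x2 $ y2 = 0 \<or> Q $ x3 $ y3 = 0"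
      using *(1) by (elim disjE exE conjE) (auto dest!: row col)
    show "P $ x1 $ y = 0 \<or> P $ x2 $ y = 0 \<or> P $ x3 $ y = 0 \<or> P $ x1 $ y1 = 0 \<or> P $ x2 $ y2 = 0 \<or> P $ x3 $ y3 = 0 \<or>
      Q $ x $ y1 = 0 \<or> Q $ x $ y2 = 0 \<or> Q $ x $ y3 = 0 \<or> Q $ x1 $ y1 = 0 \<or> Q $ x2 $ y2 = 0 \<or> Q $ x3 $ y3 = 0"
      using *(2) by (elim disjE exE conjE) (auto dest!: row col)
  qed
qed

section \<open>Support sizes and the antichain property\<close>

lemma sum_entries: "(\<Sum>e\<in>UNIV. entry e (P, Q)) = (\<Sum>i\<in>UNIV. \<Sum>j\<in>UNIV. P $ i $ j) + (\<Sum>i\<in>UNIV. \<Sum>j\<in>UNIV. Q $ i $ j)"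
proof -
  have "(\<Sum>e\<in>UNIV. entry e (P, Q)) = (\<Sum>k\<in>UNIV. \<Sum>i\<in>UNIV. \<Sum>j\<in>UNIV. entry (k, i, j) (P, Q))"
    by (simp add: sum.cartesian_product flip: UNIV_Times_UNIV)
  then show ?thesis
    by (simp add: UNIV_bool)
qed

lemma generator_01:
  assumes "g \<in> generators"
  shows "entry e g = 0 \<or> entry e g = 1"
proof -
  have "\<forall>e. entry e g = 0 \<or> entry e g = 1"
    using assms unfolding all_entries crosses_eq boxes_def diagonals_def
    by (auto simp: box_mat_def perm_mat_def cross_row_nth cross_col_nth split: if_splits)
  then show ?thesis by blast
qed

lemma card_Compl_2: "card (- A) = 2" if "card A = 2" for A :: "4 set"
  using that by (simp add: Compl_eq_Diff_UNIV card_Diff_subset)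

text \<open>Boxes and diagonals contribute 4 + 4, crosses 6 + 6. For 0/1 matrices these sums are the
  support sizes, and they also separate crosses from the other two families.\<close>

lemma sum_entries_generator:
  assumes "g \<in> generators"
  shows "(\<Sum>e\<in>UNIV. entry e g) = (if g \<in> crosses then 12 else 8)"
    and "g \<in> crosses \<Longrightarrow> g \<notin> boxes \<union> diagonals"
proof -
  have "(\<Sum>e\<in>UNIV. entry e (box_mat A B, box_mat (- A) (- B))) = 8" if "card A = 2" "card B = 2" for A B
    unfolding sum_entries box_mat_sums sum_if_mem card_Compl_2[OF that(1)] card_Compl_2[OF that(2)] that
    by simp
  then have "(\<Sum>e\<in>UNIV. entry e g) = 8" if "g \<in> boxes \<union> diagonals"
    using that unfolding boxes_def diagonals_def by (auto simp: sum_entries perm_mat_sums)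
  moreover have "(\<Sum>e\<in>UNIV. entry e g) = 12" if "g \<in> crosses"
    using that by (auto simp: crosses_eq sum_entries cross_sums sum_if_eq)
  ultimately show "(\<Sum>e\<in>UNIV. entry e g) = (if g \<in> crosses then 12 else 8)"
    and "g \<in> crosses \<Longrightarrow> g \<notin> boxes \<union> diagonals"
    using assms by auto
qed

lemma card_support:
  assumes "\<And>e. entry e x = 0 \<or> entry e x = 1"
  shows "real (card {e. entry e x \<noteq> 0}) = (\<Sum>e\<in>UNIV. entry e x)"
proof -
  have "entry e x = (if entry e x \<noteq> 0 then 1 else 0)" for e
    using assms[of e] by auto
  then have "(\<Sum>e\<in>UNIV. entry e x) = (\<Sum>e\<in>UNIV. if entry e x \<noteq> 0 then 1 else 0)"
    by presburger
  then show ?thesis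
    by (simp add: sum.If_cases)
qed

lemma entry_linear: "linear (entry e)"
  by (cases e) (auto intro!: linearI simp: entry_def)

lemma linear_Kmat_conj: "linear (\<lambda>P. Kmat ** P ** Kmat)"
proof (rule linearI)
  show "Kmat ** (P + P') ** Kmat = Kmat ** P ** Kmat + Kmat ** P' ** Kmat" for P P'
    by (simp add: matrix_add_ldistrib) (simp add: vec_eq_iff matrix_matrix_mult_def distrib_right sum.distrib)
  show "Kmat ** (t *\<^sub>R P) ** Kmat = t *\<^sub>R (Kmat ** P ** Kmat)" for t P
    by (simp add: scalar_matrix_assoc matrix_scalar_ac)
qed

lemma convex_cone_S2: "convex_cone S2"
  unfolding convex_cone_iff S2_def nonneg_mat_def
  using linear_add[OF linear_Kmat_conj] linear_scale[OF linear_Kmat_conj] linear_0[OF linear_Kmat_conj]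
  by (auto simp: zero_prod_def)

lemma S2_entry_nonneg: "x \<in> S2 \<Longrightarrow> 0 \<le> entry e x"
  by (cases x; cases e) (auto simp: entry_def S2_iff)

lemma S2_diff:
  assumes "x \<in> S2" "y \<in> S2" "\<And>e. entry e y \<le> entry e x"
  shows "x - y \<in> S2"
proof -
  obtain P Q P' Q' where xy: "x = (P, Q)" "y = (P', Q')"
    by (cases x; cases y) auto
  have "P' $ a $ b \<le> P $ a $ b" "Q' $ a $ b \<le> Q $ a $ b" for a b
    using assms(3)[of "(True, a, b)"] assms(3)[of "(False, a, b)"] by (simp_all add: xy)
  then show ?thesis
    using assms(1,2) linear_diff[OF linear_Kmat_conj] by (simp add: xy S2_def nonneg_mat_def)
qed

lemma entry_faithful: "(\<And>e. entry e x = 0) \<Longrightarrow> x = 0"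
  unfolding atomize_all all_entries by (cases x) (simp add: vec_eq_iff zero_prod_def)

interpretation S2: cone_with_functionals S2 entry generators
proof (rule cone_with_functionals.intro)
  show "0 \<notin> generators"
  proof
    assume 0: "0 \<in> generators"
    have "entry e 0 = 0" for e
      using entry_linear by (rule linear_0)
    then show False
      using sum_entries_generator(1)[OF 0] by (simp split: if_splits)
  qed
  show "generators \<subseteq> S2"
    using boxes_subset_S2 diagonals_subset_S2 crosses_subset_S2 by blast
qed (use entry_linear convex_cone_S2 S2_entry_nonneg S2_diff entry_faithful generator_below in blast)+

lemma card_supp_generator:
  assumes "g \<in> generators"
  shows "8 \<le> card (S2.supp g)" "card (S2.supp g) \<le> 12"
  using card_support[of g] sum_entries_generator(1)[OF assms] generator_01[OF assms]
  unfolding S2.supp_def by (simp_all split: if_splits)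

text \<open>If the support of \<open>h\<close> lies in that of \<open>g\<close>, then \<open>g - h\<close> is again in the cone, and its support
  has at most \<open>12 - 8\<close> elements, too few to contain the support of a generator.\<close>
interpretation S2: antichain_cone S2 entry generators
proof
  fix g h assume g: "g \<in> generators" and h: "h \<in> generators" and sub: "S2.supp h \<subseteq> S2.supp g"
  have nonzero: "entry e h \<noteq> 0 \<Longrightarrow> entry e g \<noteq> 0" for e
    using sub unfolding S2.supp_def by blast
  \<comment> \<open>For entries in {0, 1}, inclusion of supports is the entrywise
    inequality.\<close>
  have "entry e h \<le> entry e g" for e
    using nonzero[of e] generator_01[OF g, of e] generator_01[OF h, of e] by auto
  then have diff: "g - h \<in> S2"
    using g h S2.G_subset by (intro S2_diff) auto
  have "S2.supp (g - h) \<subseteq> S2.supp g - S2.supp h"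
  proof
    fix e assume "e \<in> S2.supp (g - h)"
    then have "entry e g \<noteq> entry e h"
      unfolding S2.supp_def by (simp add: linear_diff[OF entry_linear])
    then show "e \<in> S2.supp g - S2.supp h"
      using nonzero[of e] generator_01[OF g, of e] generator_01[OF h, of e]
      unfolding S2.supp_def by auto
  qed
  then have "card (S2.supp (g - h)) \<le> card (S2.supp g) - card (S2.supp h)"
    using sub by (metis card_Diff_subset card_mono finite)
  then have small: "card (S2.supp (g - h)) < 8"
    using card_supp_generator[OF g] card_supp_generator[OF h] by linarith
  have "g - h = 0"
  proof (rule ccontr)
    assume "g - h \<noteq> 0"
    then obtain k where "k \<in> generators" "S2.supp k \<subseteq> S2.supp (g - h)"
      using S2.G_below_supp[OF diff] by blast
    then show False
      using small card_supp_generator(1)[of k] card_mono[OF finite, of "S2.supp k" "S2.supp (g - h)"]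
      by linarith
  qed
  then show "h = g" by simp
qed

section \<open>Counting the generators\<close>

lemma card_boxes: "card boxes = 36"
proof -
  let ?T = "{A :: 4 set. card A = 2}"
  have T: "card ?T = 6"
    using n_subsets[of "UNIV :: 4 set" 2] by (simp add: choose_two)
  have mem: "box_mat A B $ a $ b = 1 \<longleftrightarrow> a \<in> A \<and> b \<in> B" for A B a b
    by (simp add: box_mat_def)
  have "A = A' \<and> B = B'"
    if "card A = 2" "card B = 2" "card A' = 2" "card B' = 2" "box_mat A B = box_mat A' B'" for A B A' B'
  proof -
    \<comment> \<open>The product of \<open>A\<close> and \<open>B\<close> determines its factors
      only when both are nonempty.\<close>
    have "A \<noteq> {}" "B \<noteq> {}" "A' \<noteq> {}" "B' \<noteq> {}"
      using that by auto
    moreover have "a \<in> A \<and> b \<in> B \<longleftrightarrow> a \<in> A' \<and> b \<in> B'" for a b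
      using that(5) mem by metis
    ultimately show ?thesis
      by blast
  qed
  then have inj: "inj_on (\<lambda>(A, B). (box_mat A B, box_mat (- A) (- B))) (?T \<times> ?T)"
    by (auto simp: inj_on_def)
  have eq: "boxes = (\<lambda>(A, B). (box_mat A B, box_mat (- A) (- B))) ` (?T \<times> ?T)"
    unfolding boxes_def by auto
  have "card boxes = card (?T \<times> ?T)"
    unfolding eq by (rule card_image[OF inj])
  then show ?thesis
    by (simp add: card_cartesian_product T)
qed

lemma card_diagonals: "card diagonals = 24"
proof -
  have "\<pi> = \<rho>" if "perm_mat \<pi> = perm_mat \<rho>" for \<pi> \<rho>
  proof
    fix b
    have "perm_mat \<rho> $ \<pi> b $ b = 1"
      unfolding that[symmetric] by (simp add: perm_mat_def)
    then show "\<pi> b = \<rho> b"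
      by (simp add: perm_mat_def split: if_splits)
  qed
  then have inj: "inj_on (\<lambda>\<pi>. (perm_mat \<pi>, perm_mat \<pi>)) permutations"
    by (auto simp: inj_on_def)
  have eq: "diagonals = (\<lambda>\<pi>. (perm_mat \<pi>, perm_mat \<pi>)) ` permutations"
    unfolding diagonals_def by auto
  have "card diagonals = card permutations"
    unfolding eq by (rule card_image[OF inj])
  then show ?thesis
    by (simp add: card_permutations[OF refl] fact_numeral)
qed

text \<open>The matrix reveals its parameters: \<open>j\<close> is the only zero column,
  \<open>\<pi> j\<close> the only row with sum 3, and in any other column \<open>b\<close> the one
  outside that row sits in row \<open>\<pi> b\<close>.\<close>

lemma cross_row_inj:
  assumes \<pi>: "\<pi> permutes UNIV" and \<rho>: "\<rho> permutes UNIV" and eq: "cross_row \<pi> j = cross_row \<rho> k"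
  shows "\<pi> = \<rho> \<and> j = k"
proof -
  have jk: "j = k"
    using cross_sums(2)[OF \<pi>, of j j] cross_sums(2)[OF \<rho>, of k j] eq by (simp split: if_splits)
  have \<pi>j: "\<pi> j = \<rho> j"
    using cross_sums(1)[OF \<pi>, of j "\<pi> j"] cross_sums(1)[OF \<rho>, of k "\<pi> j"] eq jk by (simp split: if_splits)
  have "\<pi> b = \<rho> b" for b
  proof (cases "b = j")
    case False
    then have "cross_row \<rho> k $ \<pi> b $ b = 1"
      unfolding eq[symmetric] by (simp add: cross_row_nth)
    moreover have "\<pi> b \<noteq> \<pi> j"
      using False permutes_inj[OF \<pi>] by (simp add: inj_eq)
    ultimately show ?thesis
      using jk \<pi>j by (simp add: cross_row_nth split: if_splits)
  qed (use \<pi>j in simp)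
  then show ?thesis
    using jk by auto
qed

text \<open>Only \<open>cross_row\<close> has a zero column; the column sums of
  \<open>cross_col\<close> are 3 and 1.\<close>

lemma cross_row_neq_cross_col:
  assumes \<pi>: "\<pi> permutes UNIV" and \<rho>: "\<rho> permutes UNIV"
  shows "cross_row \<pi> j \<noteq> cross_col \<rho> k"
proof
  assume eq: "cross_row \<pi> j = cross_col \<rho> k"
  show False
    using cross_sums(2)[OF \<pi>, of j j] cross_sums(4)[OF \<rho>, of k j] eq by (simp split: if_splits)
qed

lemma card_crosses: "card crosses = 192"
proof -
  let ?f = "\<lambda>(\<pi>, j). (cross_row \<pi> j, cross_col \<pi> j)" and ?g = "\<lambda>(\<pi>, j). (cross_col \<pi> j, cross_row \<pi> j)"
  let ?D = "permutations \<times> (UNIV :: 4 set)"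
  have "inj_on ?f ?D" "inj_on ?g ?D"
    using cross_row_inj by (auto simp: inj_on_def)
  moreover have "card ?D = 96"
    by (simp add: card_cartesian_product card_permutations[OF refl] fact_numeral)
  ultimately have "card (?f ` ?D) = 96" "card (?g ` ?D) = 96"
    by (simp_all add: card_image)
  moreover have "?f ` ?D \<inter> ?g ` ?D = {}"
    using cross_row_neq_cross_col by auto
  moreover have "finite ?D"
    by (simp add: finite_permutations)
  ultimately show ?thesis
    unfolding crosses_eq by (subst card_Un_disjoint) auto
qed

text \<open>Rows of a box sum to 0 or 2, those of a permutation matrix to 1. Any row shows the
  difference, hence \<open>undefined\<close> as its index.\<close>

lemma boxes_diagonals_disjoint: "boxes \<inter> diagonals = {}"
proof (rule equals0I)
  fix g assume "g \<in> boxes \<inter> diagonals"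
  then obtain A B \<pi> where B: "card B = 2" and \<pi>: "\<pi> permutes UNIV" and eq: "box_mat A B = perm_mat \<pi>"
    unfolding boxes_def diagonals_def by auto
  show False
    using box_mat_sums(1)[of A B undefined] perm_mat_sums(1)[OF \<pi>, of undefined] eq B
    by (simp split: if_splits)
qed

lemma card_generators: "card generators = 252"
proof -
  have fin: "finite boxes" "finite diagonals" "finite crosses"
    using card_boxes card_diagonals card_crosses by (simp_all add: card_ge_0_finite)
  have "(boxes \<union> diagonals) \<inter> crosses = {}"
    using sum_entries_generator(2) by blast
  then show ?thesis
    using fin boxes_diagonals_disjoint
    by (simp add: card_Un_disjoint card_boxes card_diagonals card_crosses)
qed

theorem mainTheorem10:
  shows "card (extremal_rays S2) = 252
    \<and> S2 = convex_cone hull (boxes \<union> diagonals \<union> crosses)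
    \<and> (\<forall>x \<in> boxes \<union> diagonals \<union> crosses. extreme_ray_gen S2 x)
    \<and> card boxes = 36 \<and> card diagonals = 24 \<and> card crosses = 192"
proof (intro conjI ballI)
  show "card (extremal_rays S2) = 252"
    unfolding S2.extremal_rays_eq using card_image[OF S2.inj_on_ray] card_generators by simp
  show "S2 = convex_cone hull (boxes \<union> diagonals \<union> crosses)"
    by (rule S2.eq_convex_cone_hull)
qed (use S2.extreme_ray_gen_G card_boxes card_diagonals card_crosses in auto)

end
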